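(* Let $(X,d)$ be a compact metric space and let $f_n:X\to X$ be continuous for every $n\ge0$, defining the non-autonomous discrete system $x_{n+1}=f_n(x_n)$, $n\ge0$. Suppose that at least one of the following holds: (1) the sequence $\{f_n\}_{n\ge0}$ satisfies Condition (P); (2) the sequence $\{f_n\}_{n\ge0}$ satisfies Condition (Q); (3) there is an increasing sequence $\{k_n\}_{n=1}^\infty$ of positive integers such that the sequence $\{\hat f_n\}_{n\ge0}$ of maps induced through $\{k_n\}_{n=1}^{\infty}$ satisfies Condition (P); (4) there is an increasing sequence $\{k_n\}_{n=1}^\infty$ of positive integers such that the sequence $\{\hat f_n\}_{n\ge0}$ of maps induced through $\{k_n\}_{n=1}^{\infty}$ satisfies Condition (Q). (Conditions (P), (Q) and the induced maps are defined in the context.) Then the system $x_{n+1}=f_n(x_n)$, $n\ge0$, is distributionally $\delta$-chaotic in a sequence for some $\delta>0$.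
   Context: "Increasing" means strictly increasing. For a sequence of maps $g_n:X\to X$, $n\ge0$, put $g_i^n:=g_{i+n-1}\circ\cdots\circ g_i$ for $i\ge0,n\ge1$, $g_i^0$ the identity, and $g_i^{-n}(B)=\{x\in X: g_i^n(x)\in B\}$. For a nonempty set $B\subset X$, $d(B):=\sup\{d(x,y):x,y\in B\}$ is its diameter. Induced maps: given an increasing sequence $\{k_n\}_{n=1}^\infty$ of positive integers, $\hat f_0:=f_{k_1-1}\circ\cdots\circ f_0$ and $\hat f_n:=f_{k_{n+1}-1}\circ\cdots\circ f_{k_n}$ for $n\ge1$. A matrix $A=(a_{ij})_{N\times N}$ ($N\ge2$) is a transition matrix if $a_{ij}\in\{0,1\}$ for all $i,j$, $\sum_{j}a_{ij}\ge1$ for all $i$, and $\sum_i a_{ij}\ge1$ for all $j$. It is irreducible if for each pair $1\le i,j\le N$ there is a positive integer $k$ such that the $(i,j)$ entry of $A^k$ is positive. $\Sigma_N^+(A):=\{(s_0,s_1,\dots): 1\le s_j\le N,\ a_{s_js_{j+1}}=1,\ j\ge0\}$. Condition (P) for a sequence of maps $g_n:X\to X$, $n\ge0$: there are $N\ge2$, an irreducible transition matrix $A=(a_{ij})_{N\times N}$ with $\sum_{j=1}^N a_{i_0j}\ge2$ for some $1\le i_0\le N$, pairwise disjoint nonempty compact subsets $V_1,\dots,V_N$ of $X$ such that each $g_n$ ($n\ge0$) is continuous in $\bigcup_{i=1}^N V_i$, and, for each $1\le i\le N$, a sequence $\{V_{i,n}\}_{n=0}^\infty$ of nonempty closed subsets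 of $V_i$, such that, with $V_\alpha^{m,n}:=\bigcap_{k=0}^m g_n^{-k}(V_{a_k,n+k})$ for $\alpha=(a_0,a_1,\dots)\in\Sigma_N^+(A)$ and $m,n\ge0$: (i) $V_\alpha^{m,n}\neq\emptyset$ for all $m,n\ge0$ and all $\alpha\in\Sigma_N^+(A)$; (ii) there exist $\beta=(b_0,b_1,\dots)\in\Sigma_N^+(A)$, an increasing sequence $\{m_k\}_{k=1}^\infty$ of positive integers, and $1\le s_0\le N$ such that $b_{m_k}=s_0$ for all $k\ge1$, and such that for every increasing sequence $\{n_k\}_{k=1}^\infty$ of nonnegative integers, $d(V_\beta^{m_k,n_k})\to0$ as $k\to\infty$. Condition (Q) is the same as Condition (P) except that (i) is replaced by: the system $x_{n+1}=g_n(x_n)$ is weakly $A$-coupled-expanding in $\{V_{i,n}\}_{n=0}^\infty$, $1\le i\le N$, that is, $V_{i,n}\cap V_{j,n}=\partial V_{i,n}\cap\partial V_{j,n}$ for all $i\ne j$, $n\ge0$ ($\partial$ denotes boundary), and $g_n(V_{i,n})\supset\bigcup_{j:\,a_{ij}=1}V_{j,n+1}$ for all $1\le i\le N$, $n\ge0$. The system $x_{n+1}=f_n(x_n)$ is distributionally $\delta$-chaotic in a sequence ($\delta>0$) if there are an increasing sequence $P=\{p_n\}_{n=1}^\infty$ of nonnegative integers and an uncountable set $D\subset X$ such that for all distinct $x,y\in D$ and every $\epsilon>0$, $$\limsup_{n\to\infty}\frac1n\sum_{i=1}^n\chi_{[0,\epsilon)}\big(d(f_0^{p_i}(x),f_0^{p_i}(y))\big)=1,\qquad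 \liminf_{n\to\infty}\frac1n\sum_{i=1}^n\chi_{[0,\delta)}\big(d(f_0^{p_i}(x),f_0^{p_i}(y))\big)=0,$$ where $\chi_{[0,\epsilon)}$ is the characteristic function of $[0,\epsilon)$. *)

theory Defs
  imports "HOL-Analysis.Analysis" "Jordan_Normal_Form.Matrix"
begin

text \<open>
  The metric space X is the whole of a type of class \<open>metric_space\<close>; compactness of X is a
  hypothesis on \<open>UNIV\<close>. The indices \<open>1, \<dots>, N\<close> of a matrix and of the associated sets
  are rendered as \<open>0, \<dots>, N - 1\<close>, the index convention of \<open>Matrix\<close>.
  A sequence indexed from 1 is a function on \<open>nat\<close> whose value at 0 is irrelevant.
\<close>

text \<open>\<open>iter_from g i n\<close> is \<open>g (i + n - 1) \<circ> \<dots> \<circ> g i\<close>.\<close>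

primrec iter_from :: "(nat \<Rightarrow> 'a \<Rightarrow> 'a) \<Rightarrow> nat \<Rightarrow> nat \<Rightarrow> 'a \<Rightarrow> 'a" where
  "iter_from g i 0 = id"
| "iter_from g i (Suc n) = g (i + n) \<circ> iter_from g i n"

definition induced_maps :: "(nat \<Rightarrow> 'a \<Rightarrow> 'a) \<Rightarrow> (nat \<Rightarrow> nat) \<Rightarrow> nat \<Rightarrow> 'a \<Rightarrow> 'a" where
  "induced_maps f k n =
     (if n = 0 then iter_from f 0 (k 1) else iter_from f (k n) (k (n + 1) - k n))"

definition transition_matrix :: "nat \<Rightarrow> nat mat \<Rightarrow> bool" where
  "transition_matrix N A \<longleftrightarrow>
     N \<ge> 2 \<and> A \<in> carrier_mat N N \<and>
     (\<forall>i<N. \<forall>j<N. A $$ (i, j) \<in> {0, 1}) \<and>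
     (\<forall>i<N. (\<Sum>j<N. A $$ (i, j)) \<ge> 1) \<and>
     (\<forall>j<N. (\<Sum>i<N. A $$ (i, j)) \<ge> 1)"

definition irreducible_matrix :: "nat \<Rightarrow> nat mat \<Rightarrow> bool" where
  "irreducible_matrix N A \<longleftrightarrow> (\<forall>i<N. \<forall>j<N. \<exists>k>0. (A ^\<^sub>m k) $$ (i, j) > 0)"

definition one_sided_shift :: "nat \<Rightarrow> nat mat \<Rightarrow> (nat \<Rightarrow> nat) set" where
  "one_sided_shift N A = {s. \<forall>j. s j < N \<and> A $$ (s j, s (Suc j)) = 1}"

text \<open>
  \<open>W i n\<close> stands for \<open>V\<^sub>i\<^sub>,\<^sub>n\<close>, and \<open>cylinder g W \<alpha> m n\<close> is the set written
  V with subscript \<open>\<alpha>\<close> and superscript \<open>m, n\<close>.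
\<close>

definition cylinder ::
  "(nat \<Rightarrow> 'a \<Rightarrow> 'a) \<Rightarrow> (nat \<Rightarrow> nat \<Rightarrow> 'a set) \<Rightarrow> (nat \<Rightarrow> nat) \<Rightarrow> nat \<Rightarrow> nat \<Rightarrow> 'a set" where
  "cylinder g W \<alpha> m n = (\<Inter>k\<in>{0..m}. iter_from g n k -` W (\<alpha> k) (n + k))"

definition coding_setup ::
  "(nat \<Rightarrow> 'a::metric_space \<Rightarrow> 'a) \<Rightarrow> nat \<Rightarrow> nat mat \<Rightarrow> (nat \<Rightarrow> 'a set) \<Rightarrow>
   (nat \<Rightarrow> nat \<Rightarrow> 'a set) \<Rightarrow> bool" where
  "coding_setup g N A V W \<longleftrightarrow>
     transition_matrix N A \<and> irreducible_matrix N A \<and>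
     (\<exists>i<N. (\<Sum>j<N. A $$ (i, j)) \<ge> 2) \<and>
     (\<forall>i<N. compact (V i) \<and> V i \<noteq> {}) \<and>
     (\<forall>i<N. \<forall>j<N. i \<noteq> j \<longrightarrow> V i \<inter> V j = {}) \<and>
     (\<forall>n. continuous_on (\<Union>i<N. V i) (g n)) \<and>
     (\<forall>i<N. \<forall>n. closed (W i n) \<and> W i n \<noteq> {} \<and> W i n \<subseteq> V i)"

definition shrinking_code ::
  "(nat \<Rightarrow> 'a::metric_space \<Rightarrow> 'a) \<Rightarrow> nat \<Rightarrow> nat mat \<Rightarrow> (nat \<Rightarrow> nat \<Rightarrow> 'a set) \<Rightarrow> bool" where
  "shrinking_code g N A W \<longleftrightarrow>
     (\<exists>\<beta> \<in> one_sided_shift N A. \<exists>m :: nat \<Rightarrow> nat. \<exists>s\<^sub>0 < N.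
        strict_mono_on {1..} m \<and> (\<forall>k\<ge>1. m k > 0) \<and> (\<forall>k\<ge>1. \<beta> (m k) = s\<^sub>0) \<and>
        (\<forall>n :: nat \<Rightarrow> nat. strict_mono_on {1..} n \<longrightarrow>
           (\<lambda>k. diameter (cylinder g W \<beta> (m k) (n k))) \<longlonglongrightarrow> 0))"

definition weakly_coupled_expanding ::
  "(nat \<Rightarrow> 'a::metric_space \<Rightarrow> 'a) \<Rightarrow> nat \<Rightarrow> nat mat \<Rightarrow> (nat \<Rightarrow> nat \<Rightarrow> 'a set) \<Rightarrow> bool" where
  "weakly_coupled_expanding g N A W \<longleftrightarrow>
     (\<forall>n. \<forall>i<N. \<forall>j<N. i \<noteq> j \<longrightarrow> W i n \<inter> W j n = frontier (W i n) \<inter> frontier (W j n)) \<and>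
     (\<forall>n. \<forall>i<N. (\<Union>j\<in>{j. j < N \<and> A $$ (i, j) = 1}. W j (n + 1)) \<subseteq> g n ` W i n)"

definition condition_P :: "(nat \<Rightarrow> 'a::metric_space \<Rightarrow> 'a) \<Rightarrow> bool" where
  "condition_P g \<longleftrightarrow>
     (\<exists>N A V W. coding_setup g N A V W \<and>
        (\<forall>m n. \<forall>\<alpha> \<in> one_sided_shift N A. cylinder g W \<alpha> m n \<noteq> {}) \<and>
        shrinking_code g N A W)"

definition condition_Q :: "(nat \<Rightarrow> 'a::metric_space \<Rightarrow> 'a) \<Rightarrow> bool" where
  "condition_Q g \<longleftrightarrow>
     (\<exists>N A V W. coding_setup g N A V W \<and>
        weakly_coupled_expanding g N A W \<and>
        shrinking_code g N A W)"

definition closeness_freq ::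
  "(nat \<Rightarrow> 'a::metric_space \<Rightarrow> 'a) \<Rightarrow> (nat \<Rightarrow> nat) \<Rightarrow> 'a \<Rightarrow> 'a \<Rightarrow> real \<Rightarrow> nat \<Rightarrow> real" where
  "closeness_freq f p x y \<epsilon> n =
     1 / real n *
       (\<Sum>i=1..n. indicator {0..<\<epsilon>} (dist (iter_from f 0 (p i) x) (iter_from f 0 (p i) y)))"

text \<open>The limits superior and inferior are taken in \<open>ereal\<close>, a complete lattice.\<close>

definition dist_chaotic_in_sequence ::
  "(nat \<Rightarrow> 'a::metric_space \<Rightarrow> 'a) \<Rightarrow> real \<Rightarrow> bool" where
  "dist_chaotic_in_sequence f \<delta> \<longleftrightarrow>
     \<delta> > 0 \<and>
     (\<exists>p :: nat \<Rightarrow> nat. strict_mono_on {1..} p \<and>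
        (\<exists>D :: 'a set. uncountable D \<and>
           (\<forall>x\<in>D. \<forall>y\<in>D. x \<noteq> y \<longrightarrow> (\<forall>\<epsilon>>0.
              limsup (\<lambda>n. ereal (closeness_freq f p x y \<epsilon> n)) = 1 \<and>
              liminf (\<lambda>n. ereal (closeness_freq f p x y \<delta> n)) = 0))))"

end

theory Submission
  imports Defs
begin

text \<open>
  Irreducibility and a state \<open>i\<close> with two successors \<open>u \<noteq> v\<close> give, for every \<open>j\<close>, two closed walks
  of the same length that start with the first \<open>m j + 1\<close> symbols of \<open>\<beta>\<close>, lead on to \<open>i\<close>, and then
  differ in the step to \<open>u\<close> or \<open>v\<close>, taken at the same time. A set \<open>s\<close> of natural numbers is coded
  by concatenating such walks, the choice in the \<open>j\<close>-th one being dictated by one bit of \<open>s\<close>.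
  By (i) and compactness there is a point \<open>x s\<close> with this code. At the beginning of the \<open>j\<close>-th walk,
  at time \<open>T j\<close>, all these points lie in one cylinder of \<open>\<beta>\<close>, whose diameter is small by (ii); at the
  branching time \<open>T j + r j\<close> two of them with different bits lie in different \<open>V\<^sub>i\<close>.
  The observation times are taken from the first kind for \<open>j \<in> {l! <.. (l + 1)!}\<close> with \<open>l\<close> even and
  from the second kind for \<open>l\<close> odd, where all \<open>j\<close> in the block read the same bit. Each such block
  outweighs everything before it, which yields the upper average 1 and the lower average 0.
  Under (Q) the cylinders are nonempty because the images cover, and the induced system is observed
  at a subsequence of the times of the original one.
\<close>

section \<open>Walks in the transition graph\<close>

text \<open>Recasts the matrix as a relation, so that walks of length \<open>k\<close> become pairs
  in \<open>edges N A ^^ k\<close>.\<close>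

definition edges :: "nat \<Rightarrow> nat mat \<Rightarrow> nat rel" where
  "edges N A = {(i, j). i < N \<and> j < N \<and> A $$ (i, j) = 1}"

text \<open>An entry of a matrix product is here a sum of natural numbers. If it is positive, so is
  one summand, and the index of that summand is the last intermediate state of a walk.\<close>

lemma mat_pow_pos_imp_relpow:
  assumes A: "A \<in> carrier_mat N N"
    and entries: "\<forall>i<N. \<forall>j<N. A $$ (i, j) \<in> {0, 1}"
    and "i < N" "j < N" "(A ^\<^sub>m k) $$ (i, j) > 0"
  shows "(i, j) \<in> edges N A ^^ k"
  using assms(4-)
proof (induction k arbitrary: j)
  case 0
  then show ?case
    using A \<open>i < N\<close> by (cases "i = j") auto
next
  case (Suc k)
  have Ak: "A ^\<^sub>m k \<in> carrier_mat N N"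
    using A by simp
  have "(A ^\<^sub>m Suc k) $$ (i, j) = (\<Sum>l<N. (A ^\<^sub>m k) $$ (i, l) * A $$ (l, j))"
    using A Ak \<open>i < N\<close> \<open>j < N\<close> by (auto simp: scalar_prod_def lessThan_atLeast0 intro!: sum.cong)
  then obtain l where l: "l < N" "(A ^\<^sub>m k) $$ (i, l) * A $$ (l, j) > 0"
    using Suc.prems(2) by (metis (no_types, lifting) lessThan_iff not_gr_zero sum.neutral)
  then have "A $$ (l, j) = 1"
    using entries Suc.prems(1) by force
  then have "(l, j) \<in> edges N A"
    using l Suc.prems(1) by (simp add: edges_def)
  then show ?case
    using Suc.IH[of l] l by auto
qed

text \<open>Going round the loop through \<open>u\<close> and the loop through \<open>v\<close> a suitable number of times
  makes the two return times agree.\<close>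

lemma synchronised_return:
  assumes "(i, u) \<in> E" "(i, v) \<in> E" "(u, i) \<in> E ^^ a" "(v, i) \<in> E ^^ b"
  obtains c where "(u, i) \<in> E ^^ c" "(v, i) \<in> E ^^ c"
proof -
  have loop: "(i, i) \<in> E ^^ (k * Suc d)" if "(i, w) \<in> E" "(w, i) \<in> E ^^ d" for w d k
  proof (induction k)
    case (Suc k)
    have "(i, i) \<in> E ^^ Suc d"
      using that by (rule relpow_Suc_I2)
    with Suc have "(i, i) \<in> E ^^ (Suc d + k * Suc d)"
      by (auto simp only: relpow_add)
    then show ?case
      by (simp only: mult_Suc)
  qed simp
  \<comment> \<open>Add \<open>b\<close> turns round the loop of length \<open>Suc a\<close> to the
    first path and \<open>a\<close> turns round the loop of length \<open>Suc b\<close> to the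
    second: both lengths become \<open>a + b + a * b\<close>.\<close>
  have "(u, i) \<in> E ^^ (a + b * Suc a)" "(v, i) \<in> E ^^ (b + a * Suc b)"
    using assms loop by (auto simp only: relpow_add)
  moreover have "b + a * Suc b = a + b * Suc a"
    by simp
  ultimately show thesis
    using that by metis
qed

text \<open>The walk follows \<beta> up to time \<open>m\<close>, goes on to \<open>i\<close> in
  \<open>k\<close> steps and then enters \<open>u\<close> or \<open>v\<close>. The ways back to
  \<open>i\<close> have the same length \<open>c\<close>, so both versions have the same total
  length.\<close>

lemma branching_block:
  fixes \<beta> :: "nat \<Rightarrow> 'b"
  assumes \<beta>: "\<And>t. (\<beta> t, \<beta> (Suc t)) \<in> E"
    and reach: "(\<beta> m, i) \<in> E ^^ k" and return: "(i, \<beta> 0) \<in> E ^^ Suc l"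
    and iu: "(i, u) \<in> E" and iv: "(i, v) \<in> E" and uv: "u \<noteq> v"
    and u: "(u, i) \<in> E ^^ c" and v: "(v, i) \<in> E ^^ c"
  shows "\<exists>L r w. r < L \<and> m \<le> L \<and> w True r \<noteq> w False r \<and>
    (\<forall>b. w b 0 = \<beta> 0 \<and> w b L = \<beta> 0 \<and> (\<forall>t\<le>m. w b t = \<beta> t) \<and>
       (\<forall>t<L. (w b t, w b (Suc t)) \<in> E))"
proof -
  obtain f where f: "f 0 = \<beta> m" "f k = i" "\<And>t. t < k \<Longrightarrow> (f t, f (Suc t)) \<in> E"
    using reach by (auto simp: relpow_fun_conv)
  have "(if b then u else v, \<beta> 0) \<in> E ^^ (c + Suc l)" for b
    using u v return by (auto simp only: relpow_add split: if_split)
  then have "\<forall>b. \<exists>g. g 0 = (if b then u else v) \<and> g (c + Suc l) = \<beta> 0 \<and>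
      (\<forall>t < c + Suc l. (g t, g (Suc t)) \<in> E)"
    unfolding relpow_fun_conv by blast
  then obtain g where g: "\<And>b. g b 0 = (if b then u else v)" "\<And>b. g b (c + Suc l) = \<beta> 0"
      "\<And>b t. t < c + Suc l \<Longrightarrow> (g b t, g b (Suc t)) \<in> E"
    by metis
  \<comment> \<open>The state \<open>i\<close> is reached at time \<open>m + k\<close>, so the
    choice between \<open>u\<close> and \<open>v\<close> shows one step later.\<close>
  define r where "r = m + k + 1"
  \<comment> \<open>From \<open>u\<close> or \<open>v\<close>, \<open>c\<close> steps lead back to
    \<open>i\<close> and \<open>Suc l\<close> more to \<open>\<beta> 0\<close>. The positive
    exponent ensures \<open>r < L\<close>.\<close>
  define L where "L = r + (c + Suc l)"
  define w where "w b t = (if t \<le> m then \<beta> t else if t \<le> m + k then f (t - m) else g b (t - r))" for b t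
  have "(w b t, w b (Suc t)) \<in> E" if "t < L" for b t
  proof -
    consider "t < m" | "m \<le> t" "t < m + k" | "t = m + k" | "m + k < t"
      by linarith
    then show ?thesis
    proof cases
      case 1
      then show ?thesis using \<beta> by (simp add: w_def)
    next
      case 2
      then show ?thesis using f(1) f(3)[of "t - m"]
        by (cases "t = m") (auto simp: w_def Suc_diff_le)
    next
      case 3
      \<comment> \<open>For \<open>k = 0\<close> this time still belongs to the initial part copied
        from \<beta>, and \<open>\<beta> m = f 0 = i\<close>.\<close>
      then have "w b t = i"
        using f(1,2) by (cases "k = 0") (auto simp: w_def)
      moreover have "w b (Suc t) = (if b then u else v)"
        using 3 g(1)[of b] by (simp add: w_def r_def)
      ultimately show ?thesis using iu iv by simp
    next
      case 4
      then have "w b t = g b (t - r)" "w b (Suc t) = g b (Suc (t - r))"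
        by (simp_all add: w_def r_def flip: Suc_diff_le)
      moreover have "t - r < c + Suc l"
        using 4 that by (simp add: r_def L_def)
      ultimately show ?thesis using g(3) by simp
    qed
  qed
  moreover have "w b r = (if b then u else v)" for b
    using g(1)[of b] by (simp add: w_def r_def)
  moreover have "w b L = \<beta> 0" for b
    using g(2)[of b] by (simp add: w_def r_def L_def)
  ultimately show ?thesis
    using uv by (intro exI[of _ L] exI[of _ r] exI[of _ w]) (auto simp: w_def r_def L_def)
qed

text \<open>All walks begin and end at \<open>s\<close>, so consecutive ones can be glued at this
  state. The seam belongs to both neighbours, hence the bound \<open>t \<le> L j\<close>.\<close>

lemma concatenate_closed_walks:
  fixes w :: "nat \<Rightarrow> nat \<Rightarrow> 'b"
  assumes L: "\<And>j. 0 < L j"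
    and ends: "\<And>j. w j 0 = s" "\<And>j. w j (L j) = s"
    and steps: "\<And>j t. t < L j \<Longrightarrow> (w j t, w j (Suc t)) \<in> E"
  obtains \<alpha> where "\<And>t. (\<alpha> t, \<alpha> (Suc t)) \<in> E"
    "\<And>j t. t \<le> L j \<Longrightarrow> \<alpha> (sum L {..<j} + t) = w j t"
proof -
  define T where "T j = sum L {..<j}" for j
  have T_Suc: "T (Suc j) = T j + L j" for j
    by (simp add: T_def)
  have mono: "strict_mono T"
    using L by (simp add: strict_mono_Suc_iff T_Suc)
  \<comment> \<open>The number of the walk in progress at time \<open>n\<close>.\<close>
  define J where "J n = (LEAST j. n < T (Suc j))" for n
  have J_eq: "J n = j" if "T j \<le> n" "n < T (Suc j)" for n j
    unfolding J_def
  proof (rule Least_equality)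
    fix y assume "n < T (Suc y)"
    then have "T j < T (Suc y)"
      using that by simp
    then show "j \<le> y"
      using strict_mono_less[OF mono] by simp
  qed fact
  define \<alpha> where "\<alpha> n = w (J n) (n - T (J n))" for n
  have \<alpha>_less: "\<alpha> (T j + t) = w j t" if "t < L j" for j t
    using J_eq[of j "T j + t"] that by (simp add: \<alpha>_def T_Suc)
  \<comment> \<open>At \<open>t = L j\<close> the value comes from the start of the next walk.
    Including it makes the step across the seam a step of the walk \<open>j\<close>.\<close>
  have \<alpha>: "\<alpha> (T j + t) = w j t" if "t \<le> L j" for j t
  proof (cases "t = L j")
    case True
    then show ?thesis
      using \<alpha>_less[of 0 "Suc j"] L ends by (simp add: T_Suc)
  qed (use that \<alpha>_less in auto)
  have "(\<alpha> n, \<alpha> (Suc n)) \<in> E" for n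
  proof -
    have ex: "n < T (Suc n)"
      using strict_mono_imp_increasing[OF mono, of "Suc n"] by simp
    have "\<exists>j. T j \<le> n \<and> n < T (Suc j)"
    proof -
      have less: "n < T (Suc (J n))"
        unfolding J_def using ex by (rule LeastI)
      have "T (J n) \<le> n"
      proof (cases "J n")
        case (Suc j)
        then show ?thesis
          using not_less_Least[of j "\<lambda>j. n < T (Suc j)"] by (simp add: J_def)
      qed (simp add: T_def)
      with less show ?thesis by blast
    qed
    then obtain j where j: "T j \<le> n" "n < T (Suc j)"
      by blast
    then obtain t where "n = T j + t" "t < L j"
      by (metis T_Suc le_Suc_ex nat_add_left_cancel_less)
    then show ?thesis
      using \<alpha>[of t j] \<alpha>[of "Suc t" j] steps[of t j] by simp
  qed
  with \<alpha> show thesis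
    unfolding T_def by (intro that[of \<alpha>]) auto
qed

section \<open>Averages along factorial blocks\<close>

text \<open>Only the first \<open>fact l\<close> of the \<open>fact (Suc l)\<close> terms can differ
  from \<open>c\<close>, each by at most 1, and they make up the proportion
  \<open>1 / Suc l\<close>.\<close>

lemma average_fact_block:
  fixes \<phi> :: "nat \<Rightarrow> real"
  assumes bounds: "\<And>i. 0 \<le> \<phi> i" "\<And>i. \<phi> i \<le> 1" and c: "0 \<le> c" "c \<le> 1"
    and block: "\<And>i. i \<in> {fact l<..fact (Suc l)} \<Longrightarrow> \<phi> i = c"
  shows "\<bar>1 / real (fact (Suc l)) * sum \<phi> {1..fact (Suc l)} - c\<bar> \<le> 1 / real (Suc l)"
proof -
  have split: "{1..fact (Suc l) :: nat} = {1..fact l} \<union> {fact l<..fact (Suc l)}"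
    using fact_mono_nat[of l "Suc l"] fact_ge_1[of l, where 'a = nat]
    by (auto simp del: fact_Suc)
  have le: "(fact l :: nat) \<le> fact (Suc l)"
    by (rule fact_mono_nat) simp
  have "sum \<phi> {1..fact (Suc l)} = sum \<phi> {1..fact l} + sum \<phi> {fact l<..fact (Suc l)}"
    unfolding split by (rule sum.union_disjoint) auto
  also have "sum \<phi> {fact l<..fact (Suc l)} = (real (fact (Suc l)) - real (fact l)) * c"
    using block le by (simp add: of_nat_diff del: fact_Suc)
  finally have sum_eq: "sum \<phi> {1..fact (Suc l)} - real (fact (Suc l)) * c =
      sum \<phi> {1..fact l} - real (fact l) * c"
    by (simp add: algebra_simps del: fact_Suc)
  have "0 \<le> sum \<phi> {1..fact l}" "sum \<phi> {1..fact l} \<le> real (fact l)"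
    using sum_nonneg[of "{1..fact l}" \<phi>] sum_bounded_above[of "{1..fact l}" \<phi> 1] bounds by auto
  moreover have "0 \<le> real (fact l) * c" "real (fact l) * c \<le> real (fact l)"
    using c by (auto intro: mult_left_le)
  ultimately have "\<bar>sum \<phi> {1..fact (Suc l)} - real (fact (Suc l)) * c\<bar> \<le> real (fact l)"
    unfolding sum_eq by linarith
  then have "\<bar>sum \<phi> {1..fact (Suc l)} - real (fact (Suc l)) * c\<bar> / real (fact (Suc l)) \<le>
      real (fact l) / real (fact (Suc l))"
    by (rule divide_right_mono) simp
  also have "real (fact l) / real (fact (Suc l)) = 1 / real (Suc l)"
  proof -
    have eq: "real (fact (Suc l)) = real (Suc l) * real (fact l)"
      by (simp add: algebra_simps)
    show ?thesis
      unfolding eq by (rule nonzero_divide_mult_cancel_right) simp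
  qed
  also have "\<bar>sum \<phi> {1..fact (Suc l)} - real (fact (Suc l)) * c\<bar> / real (fact (Suc l)) =
      \<bar>1 / real (fact (Suc l)) * sum \<phi> {1..fact (Suc l)} - c\<bar>"
  proof -
    have "1 / real (fact (Suc l)) * sum \<phi> {1..fact (Suc l)} - c =
        (sum \<phi> {1..fact (Suc l)} - real (fact (Suc l)) * c) / real (fact (Suc l))"
      by (simp add: diff_divide_distrib del: fact_Suc)
    then show ?thesis
      by (simp only: abs_divide)
  qed
  finally show ?thesis .
qed

text \<open>Average up to the right ends of the good blocks. The \<open>n\<close>-th good level is
  at least \<open>n\<close>, so the error there is at most \<open>1 / Suc n\<close>.\<close>

lemma averages_subseq_tendsto:
  fixes \<phi> :: "nat \<Rightarrow> real"
  assumes bounds: "\<And>i. 0 \<le> \<phi> i" "\<And>i. \<phi> i \<le> 1" and c: "0 \<le> c" "c \<le> 1"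
    and inf: "infinite {l. \<forall>i\<in>{fact l<..fact (Suc l)}. \<phi> i = c}"
  obtains r :: "nat \<Rightarrow> nat" where "strict_mono r"
    "(\<lambda>n. 1 / real (r n) * sum \<phi> {1..r n}) \<longlonglongrightarrow> c"
proof -
  define S where "S = {l. \<forall>i\<in>{fact l<..fact (Suc l)}. \<phi> i = c}"
  define e where "e = enumerate S"
  \<comment> \<open>The argument \<open>Suc (e n)\<close> stays in the range where the factorial is
    strictly increasing; \<open>fact 0 = fact 1\<close>.\<close>
  define r :: "nat \<Rightarrow> nat" where "r n = fact (Suc (e n))" for n
  have inf: "infinite S"
    using inf by (fold S_def)
  have e_mono: "strict_mono e"
    unfolding e_def using inf by (rule strict_mono_enumerate)
  have "strict_mono r"
  proof (rule strict_monoI)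
    fix x y :: nat assume "x < y"
    then show "r x < r y"
      using strict_monoD[OF e_mono, of x y] unfolding r_def by (simp add: fact_less_mono_nat del: fact_Suc)
  qed
  moreover have "(\<lambda>n. 1 / real (r n) * sum \<phi> {1..r n} - c) \<longlonglongrightarrow> 0"
  proof (rule Lim_null_comparison)
    have "norm (1 / real (r n) * sum \<phi> {1..r n} - c) \<le> 1 / real (Suc n)" for n
    proof -
      have "e n \<in> S"
        unfolding e_def using inf by (rule enumerate_in_set)
      then have "\<phi> i = c" if "i \<in> {fact (e n)<..fact (Suc (e n))}" for i
        using that unfolding S_def by blast
      from average_fact_block[of \<phi> c "e n", OF bounds c this]
      have "norm (1 / real (r n) * sum \<phi> {1..r n} - c) \<le> 1 / real (Suc (e n))"
        unfolding r_def real_norm_def .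
      also have "\<dots> \<le> 1 / real (Suc n)"
        using strict_mono_imp_increasing[OF e_mono, of n] by (intro frac_le) auto
      finally show ?thesis .
    qed
    then show "\<forall>\<^sub>F n in sequentially. norm (1 / real (r n) * sum \<phi> {1..r n} - c) \<le> 1 / real (Suc n)"
      by (intro always_eventually allI)
    show "(\<lambda>n. 1 / real (Suc n)) \<longlonglongrightarrow> 0"
      using LIMSEQ_inverse_real_of_nat by (simp only: inverse_eq_divide)
  qed
  ultimately show thesis
    by (rule that[OF _ LIM_zero_cancel])
qed

text \<open>All averages lie between 0 and 1, so a subsequence converging to an end point already
  determines the upper or the lower limit.\<close>

lemma averages_limsup_liminf:
  fixes \<phi> :: "nat \<Rightarrow> real"
  assumes bounds: "\<And>i. 0 \<le> \<phi> i" "\<And>i. \<phi> i \<le> 1"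
  defines "av \<equiv> \<lambda>n. ereal (1 / real n * sum \<phi> {1..n})"
  shows "infinite {l. \<forall>i\<in>{fact l<..fact (Suc l)}. \<phi> i = 1} \<Longrightarrow> limsup av = 1"
    and "infinite {l. \<forall>i\<in>{fact l<..fact (Suc l)}. \<phi> i = 0} \<Longrightarrow> liminf av = 0"
proof -
  have av: "0 \<le> av n" "av n \<le> 1" for n
    using sum_nonneg[of "{1..n}" \<phi>] sum_bounded_above[of "{1..n}" \<phi> 1] bounds
    by (auto simp: av_def divide_le_eq_1)
  show "limsup av = 1" if inf: "infinite {l. \<forall>i\<in>{fact l<..fact (Suc l)}. \<phi> i = 1}"
  proof (rule antisym)
    show "limsup av \<le> 1"
      using av by (intro Limsup_bounded) auto
    obtain r :: "nat \<Rightarrow> nat" where r: "strict_mono r" "(\<lambda>n. 1 / real (r n) * sum \<phi> {1..r n}) \<longlonglongrightarrow> 1"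
      using averages_subseq_tendsto[OF bounds _ _ inf] by auto
    then have "(av \<circ> r) \<longlonglongrightarrow> 1"
      by (simp add: av_def o_def one_ereal_def)
    then have "limsup (av \<circ> r) = 1"
      by (intro lim_imp_Limsup) auto
    then show "1 \<le> limsup av"
      using limsup_subseq_mono[OF r(1), of av] by simp
  qed
  show "liminf av = 0" if inf: "infinite {l. \<forall>i\<in>{fact l<..fact (Suc l)}. \<phi> i = 0}"
  proof (rule antisym)
    show "0 \<le> liminf av"
      using av by (intro Liminf_bounded) auto
    obtain r :: "nat \<Rightarrow> nat" where r: "strict_mono r" "(\<lambda>n. 1 / real (r n) * sum \<phi> {1..r n}) \<longlonglongrightarrow> 0"
      using averages_subseq_tendsto[OF bounds _ _ inf] by auto
    then have "(av \<circ> r) \<longlonglongrightarrow> 0"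
      by (simp add: av_def o_def zero_ereal_def)
    then have "liminf (av \<circ> r) = 0"
      by (intro lim_imp_Liminf) auto
    then show "liminf av \<le> 0"
      using liminf_subseq_mono[OF r(1), of av] by simp
  qed
qed

section \<open>Orbits with prescribed codes\<close>

lemma iter_from_add: "iter_from g n (a + b) = iter_from g (n + a) b \<circ> iter_from g n a"
  by (induction b) (auto simp: fun_eq_iff add.assoc)

lemma continuous_on_iter_from:
  assumes "\<And>n. continuous_on UNIV (g n)"
  shows "continuous_on UNIV (iter_from g i n)"
proof (induction n)
  case (Suc n)
  then have "continuous_on UNIV (g (i + n) \<circ> iter_from g i n)"
    using continuous_on_subset[OF assms subset_UNIV] by (rule continuous_on_compose)
  then show ?case
    by simp
qed (simp add: id_def)

lemma cylinder_iff:
  "x \<in> cylinder g W \<alpha> m n \<longleftrightarrow> (\<forall>k\<le>m. iter_from g n k x \<in> W (\<alpha> k) (n + k))"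
  by (auto simp: cylinder_def)

text \<open>The cylinders are closed by continuity of the iterates and decrease in \<open>m\<close>,
  so compactness gives a point common to all of them.\<close>

lemma exists_orbit_with_code:
  fixes g :: "nat \<Rightarrow> 'a::metric_space \<Rightarrow> 'a"
  assumes X: "compact (UNIV :: 'a set)" and g: "\<And>n. continuous_on UNIV (g n)"
    and W: "\<And>k. closed (W (\<alpha> k) k)" and ne: "\<And>m. cylinder g W \<alpha> m 0 \<noteq> {}"
  shows "\<exists>x. \<forall>k. iter_from g 0 k x \<in> W (\<alpha> k) k"
proof -
  have "closed (cylinder g W \<alpha> m 0)" for m
    unfolding cylinder_def using W continuous_on_iter_from[OF g]
    by (intro closed_INT ballI closed_vimage) (simp_all only: add_0)
  moreover have "UNIV \<inter> (\<Inter>m\<in>I. cylinder g W \<alpha> m 0) \<noteq> {}" if "finite I" for I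
  proof -
    \<comment> \<open>The cylinder at the largest index lies in all the others; inserting 0 covers
      the empty \<open>I\<close>.\<close>
    have "k \<le> Max (insert 0 I)" if "m \<in> I" "k \<le> m" for k m
    proof -
      have "m \<le> Max (insert 0 I)"
        using \<open>finite I\<close> \<open>m \<in> I\<close> by (intro Max_ge) auto
      with \<open>k \<le> m\<close> show ?thesis
        by (rule order_trans)
    qed
    moreover obtain x where "x \<in> cylinder g W \<alpha> (Max (insert 0 I)) 0"
      using ne by blast
    ultimately have "x \<in> cylinder g W \<alpha> m 0" if "m \<in> I" for m
      using that unfolding cylinder_iff by blast
    then show ?thesis
      by blast
  qed
  ultimately have "UNIV \<inter> (\<Inter>m. cylinder g W \<alpha> m 0) \<noteq> {}"
    by (rule compact_imp_fip_image[OF X])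
  then obtain x where "\<And>m. x \<in> cylinder g W \<alpha> m 0"
    by blast
  then have "iter_from g 0 k x \<in> W (\<alpha> k) k" for k
    unfolding cylinder_iff by (metis add_0 order_refl)
  then show ?thesis
    by blast
qed

section \<open>Separation of disjoint sets and counting\<close>

text \<open>The distance to \<open>T\<close> attains its minimum on the compact \<open>S\<close>,
  and the minimum is positive because \<open>T\<close> is closed and misses \<open>S\<close>. If one
  set is empty, any positive number serves.\<close>

lemma compact_closed_separated:
  fixes S T :: "'a::metric_space set"
  assumes S: "compact S" and T: "closed T" and disj: "S \<inter> T = {}"
  shows "\<exists>d>0. \<forall>x\<in>S. \<forall>y\<in>T. d \<le> dist x y"
proof (cases "S = {} \<or> T = {}")
  case False
  have "continuous_on S (\<lambda>z. infdist z T)"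
    by (intro continuous_intros)
  then obtain x where x: "x \<in> S" "\<And>z. z \<in> S \<Longrightarrow> infdist x T \<le> infdist z T"
    using continuous_attains_inf[OF S] False by blast
  have "infdist x T > 0"
    using x(1) False T disj in_closed_iff_infdist_zero[of T x] infdist_nonneg[of x T] by fastforce
  then show ?thesis
    using x(2) infdist_le by (metis order_trans)
qed (auto intro: exI[of _ 1])

lemma disjoint_compacts_separated:
  fixes V :: "nat \<Rightarrow> 'a::metric_space set"
  assumes V: "\<And>i. i < N \<Longrightarrow> compact (V i)"
    and disj: "\<And>i j. i < N \<Longrightarrow> j < N \<Longrightarrow> i \<noteq> j \<Longrightarrow> V i \<inter> V j = {}"
  obtains \<delta> where "\<delta> > 0"
    "\<And>i j x y. i < N \<Longrightarrow> j < N \<Longrightarrow> i \<noteq> j \<Longrightarrow> x \<in> V i \<Longrightarrow> y \<in> V j \<Longrightarrow> \<delta> \<le> dist x y"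
proof -
  have "\<exists>d>0. i < N \<longrightarrow> j < N \<longrightarrow> i \<noteq> j \<longrightarrow> (\<forall>x\<in>V i. \<forall>y\<in>V j. d \<le> dist x y)" for i j
  proof (cases "i < N \<and> j < N \<and> i \<noteq> j")
    case True
    then show ?thesis
      using compact_closed_separated[of "V i" "V j"] V disj compact_imp_closed by metis
  qed (auto intro: exI[of _ 1])
  then obtain d where d: "\<And>i j. d i j > 0"
      "\<And>i j x y. i < N \<Longrightarrow> j < N \<Longrightarrow> i \<noteq> j \<Longrightarrow> x \<in> V i \<Longrightarrow> y \<in> V j \<Longrightarrow> d i j \<le> dist x y"
    by metis
  \<comment> \<open>Finitely many pairs, so a minimum exists; inserting 1 keeps the set
    nonempty.\<close>
  define D where "D = insert 1 ((\<lambda>(i, j). d i j) ` ({..<N} \<times> {..<N}))"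
  have D: "finite D" "D \<noteq> {}" "\<And>z. z \<in> D \<Longrightarrow> z > 0"
    using d(1) by (auto simp: D_def)
  show thesis
  proof (rule that[of "Min D"])
    show "Min D > 0"
      using D by simp
    show "Min D \<le> dist x y" if "i < N" "j < N" "i \<noteq> j" "x \<in> V i" "y \<in> V j" for i j x y
    proof -
      have "Min D \<le> d i j"
        using that D(1) by (intro Min_le) (auto simp: D_def)
      then show ?thesis
        using d(2)[OF that] by simp
    qed
  qed
qed

lemma uncountable_UNIV_nat_set: "uncountable (UNIV :: nat set set)"
proof
  assume "countable (UNIV :: nat set set)"
  then obtain f :: "nat \<Rightarrow> nat set" where "range f = UNIV"
    using range_from_nat_into by blast
  then show False
    using Cantors_theorem[of "UNIV :: nat set"] by auto
qed

text \<open>For entries 0 and 1 the row sum counts the successors of \<open>i\<close>.\<close>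

lemma two_successors:
  assumes entries: "\<forall>j<N. A $$ (i, j) \<in> {0, 1}" and "(\<Sum>j<N. A $$ (i, j)) \<ge> (2::nat)"
  obtains u v where "u < N" "v < N" "u \<noteq> v" "A $$ (i, u) = 1" "A $$ (i, v) = 1"
proof -
  define S where "S = {j \<in> {..<N}. A $$ (i, j) = 1}"
  have "(\<Sum>j<N. A $$ (i, j)) = (\<Sum>j<N. if A $$ (i, j) = 1 then 1 else 0)"
    using entries by (intro sum.cong) auto
  also have "\<dots> = card S"
    by (simp add: S_def sum.If_cases Int_def)
  finally have "\<not> card S \<le> Suc 0"
    using assms(2) by simp
  moreover have "finite S"
    by (simp add: S_def)
  ultimately show thesis
    using that card_le_Suc0_iff_eq[of S] by (auto simp: S_def)
qed

section \<open>A criterion for distributional chaos\<close>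

text \<open>The \<open>l\<close> whose block \<open>{fact l<..fact (Suc l)}\<close> contains
  \<open>i\<close>. The indices 0 and 1 lie in no block and get level 0.\<close>

definition factorial_level :: "nat \<Rightarrow> nat" where
  "factorial_level i = (LEAST l. i \<le> fact (Suc l))"

lemma factorial_level_eq:
  assumes "i \<in> {fact l<..fact (Suc l)}"
  shows "factorial_level i = l"
  unfolding factorial_level_def
proof (rule Least_equality)
  fix y assume y: "i \<le> fact (Suc y)"
  show "l \<le> y"
  proof (rule ccontr)
    assume "\<not> l \<le> y"
    then have "(fact (Suc y) :: nat) \<le> fact l"
      by (intro fact_mono_nat) simp
    with y assms show False
      by (simp del: fact_Suc)
  qed
qed (use assms in simp)

text \<open>The points \<open>x s\<close> are close together at the times \<open>T i\<close> and can
  be told apart at the times \<open>T i + r i\<close>. Throughout the block of level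
  \<open>l\<close> the bit read from \<open>s\<close> is membership of \<open>h l\<close>. Blocks of
  even level give the upper average 1, blocks of odd level the lower average 0.\<close>

lemma dist_chaotic_if_synchronised:
  fixes g :: "nat \<Rightarrow> 'a::metric_space \<Rightarrow> 'a" and x :: "nat set \<Rightarrow> 'a"
  assumes \<delta>: "\<delta> > 0" and T: "strict_mono T" and r: "\<And>i. T i + r i < T (Suc i)"
    and bit: "\<And>s t. s \<noteq> t \<Longrightarrow> infinite {l. odd l \<and> (h l \<in> s) \<noteq> (h l \<in> t)}"
    and close: "\<And>\<epsilon>. \<epsilon> > 0 \<Longrightarrow> \<exists>K. \<forall>i\<ge>K. \<forall>s t.
      dist (iter_from g 0 (T i) (x s)) (iter_from g 0 (T i) (x t)) < \<epsilon>"
    and far: "\<And>i s t. (h (factorial_level i) \<in> s) \<noteq> (h (factorial_level i) \<in> t) \<Longrightarrow>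
      \<delta> \<le> dist (iter_from g 0 (T i + r i) (x s)) (iter_from g 0 (T i + r i) (x t))"
  shows "dist_chaotic_in_sequence g \<delta>"
proof -
  define p where "p i = (if even (factorial_level i) then T i else T i + r i)" for i
  have p_bounds: "T i \<le> p i" "p i < T (Suc i)" for i
    using r[of i] by (auto simp: p_def)
  \<comment> \<open>Either choice of \<open>p i\<close> stays in the interval from
    \<open>T i\<close> to \<open>T (Suc i)\<close>, so switching between the two kinds keeps the
    times increasing.\<close>
  have "p i < p (Suc i)" for i
    using p_bounds(2)[of i] p_bounds(1)[of "Suc i"] by linarith
  then have p: "strict_mono p"
    by (simp add: strict_mono_Suc_iff)
  define \<phi> :: "nat set \<Rightarrow> nat set \<Rightarrow> real \<Rightarrow> nat \<Rightarrow> real" where "\<phi> s t \<epsilon> i =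
    indicator {0..<\<epsilon>} (dist (iter_from g 0 (p i) (x s)) (iter_from g 0 (p i) (x t)))"
    for s t \<epsilon> i
  have \<phi>: "0 \<le> \<phi> s t \<epsilon> i" "\<phi> s t \<epsilon> i \<le> 1" for s t \<epsilon> i
    by (auto simp: \<phi>_def indicator_def)
  have limsup: "limsup (\<lambda>n. ereal (closeness_freq g p (x s) (x t) \<epsilon> n)) = 1" if "\<epsilon> > 0" for s t \<epsilon>
  proof -
    obtain K where K: "\<And>i. i \<ge> K \<Longrightarrow>
        dist (iter_from g 0 (T i) (x s)) (iter_from g 0 (T i) (x t)) < \<epsilon>"
      using close[OF \<open>\<epsilon> > 0\<close>] by blast
    have block: "\<phi> s t \<epsilon> i = 1" if "K \<le> l" "even l" "i \<in> {fact l<..fact (Suc l)}" for i l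
    proof -
      have "K \<le> i"
        using that fact_ge_self[of l] by (simp del: fact_Suc)
      moreover have "p i = T i"
        using factorial_level_eq[OF that(3)] that(2) by (simp add: p_def)
      ultimately show ?thesis
        using K[of i] by (simp add: \<phi>_def)
    qed
    have "\<exists>l\<ge>q. \<forall>i\<in>{fact l<..fact (Suc l)}. \<phi> s t \<epsilon> i = 1" for q
    proof (intro exI conjI ballI)
      \<comment> \<open>The witness \<open>2 * (K + q)\<close> is an even level that is at least
        \<open>K\<close> and at least \<open>q\<close>.\<close>
      show "\<phi> s t \<epsilon> i = 1"
        if "i \<in> {fact (2 * (K + q))<..fact (Suc (2 * (K + q)))}" for i
        using that by (rule block[rotated 2]) simp_all
    qed simp
    then have "infinite {l. \<forall>i\<in>{fact l<..fact (Suc l)}. \<phi> s t \<epsilon> i = 1}"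
      unfolding infinite_nat_iff_unbounded_le by blast
    from averages_limsup_liminf(1)[of "\<phi> s t \<epsilon>", OF \<phi> this] show ?thesis
      by (simp add: closeness_freq_def \<phi>_def)
  qed
  have liminf: "liminf (\<lambda>n. ereal (closeness_freq g p (x s) (x t) \<delta> n)) = 0" if "s \<noteq> t" for s t
  proof -
    have "\<phi> s t \<delta> i = 0"
      if "odd l" "(h l \<in> s) \<noteq> (h l \<in> t)" "i \<in> {fact l<..fact (Suc l)}" for i l
      using far[of i s t] factorial_level_eq[OF that(3)] that(1,2) by (simp add: \<phi>_def p_def)
    then have "{l. odd l \<and> (h l \<in> s) \<noteq> (h l \<in> t)} \<subseteq>
        {l. \<forall>i\<in>{fact l<..fact (Suc l)}. \<phi> s t \<delta> i = 0}"
      by blast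
    then have "infinite {l. \<forall>i\<in>{fact l<..fact (Suc l)}. \<phi> s t \<delta> i = 0}"
      using bit[OF that] infinite_super by blast
    from averages_limsup_liminf(2)[of "\<phi> s t \<delta>", OF \<phi> this] show ?thesis
      by (simp add: closeness_freq_def \<phi>_def)
  qed
  have "inj x"
  proof (rule injI, rule ccontr)
    fix s t assume eq: "x s = x t" and "s \<noteq> t"
    then have "{l. odd l \<and> (h l \<in> s) \<noteq> (h l \<in> t)} \<noteq> {}"
      using bit infinite_imp_nonempty by blast
    then obtain l where l: "odd l" "(h l \<in> s) \<noteq> (h l \<in> t)"
      by blast
    \<comment> \<open>The right end of the block is a sample index of level \<open>l\<close>;
      \<open>l\<close> is odd, so the block is not the empty one of level 0.\<close>
    have "factorial_level (fact (Suc l)) = l"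
    proof (rule factorial_level_eq)
      have "(fact l :: nat) < fact (Suc l)"
        using l(1) by (intro fact_less_mono_nat) (auto intro: odd_pos)
      then show "fact (Suc l) \<in> {fact l<..fact (Suc l) :: nat}"
        by (simp del: fact_Suc)
    qed
    then show False
      using far[of "fact (Suc l)" s t] l(2) eq \<delta> by simp
  qed
  then have "uncountable (range x)"
    using uncountable_UNIV_nat_set countable_image_inj_on by blast
  moreover have "strict_mono_on {1..} p"
    using p by (auto intro!: strict_mono_onI dest: strict_monoD)
  moreover have "limsup (\<lambda>n. ereal (closeness_freq g p y z \<epsilon> n)) = 1 \<and>
      liminf (\<lambda>n. ereal (closeness_freq g p y z \<delta> n)) = 0"
    if "y \<in> range x" "z \<in> range x" "y \<noteq> z" "\<epsilon> > 0" for y z \<epsilon>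
    using that limsup liminf by (metis rangeE)
  ultimately show ?thesis
    unfolding dist_chaotic_in_sequence_def using \<delta> by blast
qed

section \<open>From Condition (P) to distributional chaos\<close>

lemma one_sided_shift_iff:
  "s \<in> one_sided_shift N A \<longleftrightarrow> (\<forall>t. (s t, s (Suc t)) \<in> edges N A)"
  by (auto simp: one_sided_shift_def edges_def)

text \<open>The first component of the decoded pair names the bit and the second is free, so every
  bit is read at arbitrarily high odd levels. One element on which \<open>s\<close> and
  \<open>t\<close> disagree therefore suffices.\<close>

lemma infinite_odd_separating_levels:
  assumes "s \<noteq> t"
  shows "infinite {l. odd l \<and> (fst (prod_decode (l div 2)) \<in> s) \<noteq> (fst (prod_decode (l div 2)) \<in> t)}"
proof -
  obtain j where j: "(j \<in> s) \<noteq> (j \<in> t)"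
    using assms by blast
  have "\<exists>l\<ge>q. odd l \<and> fst (prod_decode (l div 2)) = j" for q
  proof (intro exI conjI)
    show "q \<le> 2 * prod_encode (j, q) + 1"
      using le_prod_encode_2[of q j] by simp
  qed simp_all
  then show ?thesis
    unfolding infinite_nat_iff_unbounded_le using j by blast
qed

lemma condition_P_imp_dist_chaotic:
  fixes g :: "nat \<Rightarrow> 'a::metric_space \<Rightarrow> 'a"
  assumes X: "compact (UNIV :: 'a set)" and g: "\<And>n. continuous_on UNIV (g n)"
    and P: "condition_P g"
  shows "\<exists>\<delta>. dist_chaotic_in_sequence g \<delta>"
proof -
  obtain N A V W where coding: "coding_setup g N A V W"
    and ne: "\<And>m n \<alpha>. \<alpha> \<in> one_sided_shift N A \<Longrightarrow> cylinder g W \<alpha> m n \<noteq> {}"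
    and shrink: "shrinking_code g N A W"
    using P unfolding condition_P_def by blast
  define E where "E = edges N A"
  have trans: "transition_matrix N A" and irr: "irreducible_matrix N A"
    and branch: "\<exists>i<N. (\<Sum>j<N. A $$ (i, j)) \<ge> 2"
    and V_compact: "\<forall>i<N. compact (V i) \<and> V i \<noteq> {}"
    and V_disjoint: "\<forall>i<N. \<forall>j<N. i \<noteq> j \<longrightarrow> V i \<inter> V j = {}"
    and W_V: "\<forall>i<N. \<forall>n. closed (W i n) \<and> W i n \<noteq> {} \<and> W i n \<subseteq> V i"
    using coding unfolding coding_setup_def by simp_all
  have A: "A \<in> carrier_mat N N" and entries: "\<forall>i<N. \<forall>j<N. A $$ (i, j) \<in> {0, 1}"
    using trans unfolding transition_matrix_def by simp_all
  have V: "compact (V i)" "j < N \<Longrightarrow> i \<noteq> j \<Longrightarrow> V i \<inter> V j = {}"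
    and W: "closed (W i n)" "W i n \<subseteq> V i" if "i < N" for i j n
    using that V_compact V_disjoint W_V by simp_all
  obtain i where i: "i < N" "(\<Sum>j<N. A $$ (i, j)) \<ge> 2"
    using branch by (elim exE conjE)
  obtain u v where uv: "u < N" "v < N" "u \<noteq> v" "A $$ (i, u) = 1" "A $$ (i, v) = 1"
    using two_successors[of N A i] entries i by blast
  have iuv: "(i, u) \<in> E" "(i, v) \<in> E"
    using i uv by (auto simp: E_def edges_def)
  have connected: "\<exists>k. (a, b) \<in> E ^^ Suc k" if ab: "a < N" "b < N" for a b
  proof -
    obtain k where "k > 0" "(A ^\<^sub>m k) $$ (a, b) > 0"
      using irr ab unfolding irreducible_matrix_def by metis
    then show ?thesis
      using mat_pow_pos_imp_relpow[OF A entries ab, of k] unfolding E_def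
      by (intro exI[of _ "k - 1"]) (simp del: relpow.simps)
  qed
  obtain a b where "(u, i) \<in> E ^^ a" "(v, i) \<in> E ^^ b"
    using connected[OF uv(1) i(1)] connected[OF uv(2) i(1)] by (elim exE)
  then obtain c where c: "(u, i) \<in> E ^^ c" "(v, i) \<in> E ^^ c"
    using synchronised_return[OF iuv] by blast
  obtain \<beta> and m :: "nat \<Rightarrow> nat" where \<beta>: "\<beta> \<in> one_sided_shift N A"
    and m: "\<And>n :: nat \<Rightarrow> nat. strict_mono_on {1..} n \<Longrightarrow>
      (\<lambda>k. diameter (cylinder g W \<beta> (m k) (n k))) \<longlonglongrightarrow> 0"
    using shrink unfolding shrinking_code_def by blast
  have \<beta>E: "(\<beta> t, \<beta> (Suc t)) \<in> E" and \<beta>N: "\<beta> t < N" for t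
    using \<beta> by (auto simp: one_sided_shift_def E_def edges_def)
  \<comment> \<open>The outcome of \<open>branching_block\<close> for the prefix length
    \<open>m j\<close>, as a predicate so that it can be chosen for all \<open>j\<close> at once.
    Any value of \<open>m 0\<close> will do, since blocks exist for every prefix length.\<close>
  define Q where "Q j L r w \<longleftrightarrow> r < L \<and> m j \<le> L \<and> w True r \<noteq> w False r \<and>
    (\<forall>b. w b 0 = \<beta> 0 \<and> w b L = \<beta> 0 \<and> (\<forall>t\<le>m j. w b t = \<beta> t) \<and>
       (\<forall>t<L. (w b t, w b (Suc t)) \<in> E))" for j L r and w :: "bool \<Rightarrow> nat \<Rightarrow> nat"
  have "\<exists>L r w. Q j L r w" for j
  proof -
    obtain k where k: "(\<beta> (m j), i) \<in> E ^^ Suc k"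
      using connected[OF \<beta>N i(1)] by blast
    obtain l where l: "(i, \<beta> 0) \<in> E ^^ Suc l"
      using connected[OF i(1) \<beta>N] by blast
    show ?thesis
      unfolding Q_def by (rule branching_block[OF \<beta>E k l iuv uv(3) c])
  qed
  then obtain L r w where Q: "\<And>j. Q j (L j) (r j) (w j)"
    by metis
  have L: "r j < L j" "0 < L j" "m j \<le> L j" for j
    using Q[of j] by (auto simp: Q_def)
  \<comment> \<open>The lengths do not depend on the set \<open>s\<close>, so the blocks of all
    codes start at the same times.\<close>
  define T where "T j = sum L {..<j}" for j
  define h where "h l = fst (prod_decode (l div 2))" for l
  have "\<exists>x \<alpha>. \<alpha> \<in> one_sided_shift N A \<and> (\<forall>k. iter_from g 0 k x \<in> W (\<alpha> k) k) \<and>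
      (\<forall>j. \<forall>t\<le>L j. \<alpha> (T j + t) = w j (h (factorial_level j) \<in> s) t)" for s
  proof -
    define block where "block j = w j (h (factorial_level j) \<in> s)" for j
    have "block j 0 = \<beta> 0" "block j (L j) = \<beta> 0" "t < L j \<Longrightarrow> (block j t, block j (Suc t)) \<in> E" for j t
      using Q[of j] unfolding Q_def block_def by simp_all
    then obtain \<alpha> where \<alpha>: "\<And>t. (\<alpha> t, \<alpha> (Suc t)) \<in> E"
      "\<And>j t. t \<le> L j \<Longrightarrow> \<alpha> (sum L {..<j} + t) = block j t"
      using concatenate_closed_walks[of L block "\<beta> 0" E, OF L(2)] by metis
    then have shift: "\<alpha> \<in> one_sided_shift N A"
      by (simp add: one_sided_shift_iff E_def)
    then have "closed (W (\<alpha> k) k)" for k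
      using W(1) by (simp add: one_sided_shift_def)
    then obtain x where "\<forall>k. iter_from g 0 k x \<in> W (\<alpha> k) k"
      using exists_orbit_with_code[OF X g _ ne[OF shift]] by blast
    with \<alpha>(2) shift show ?thesis
      unfolding T_def block_def by blast
  qed
  then obtain x \<alpha> where \<alpha>: "\<And>s. \<alpha> s \<in> one_sided_shift N A"
    and x: "\<And>s k. iter_from g 0 k (x s) \<in> W (\<alpha> s k) k"
    and \<alpha>w: "\<And>s j t. t \<le> L j \<Longrightarrow> \<alpha> s (T j + t) = w j (h (factorial_level j) \<in> s) t"
    by metis
  have \<alpha>N: "\<alpha> s k < N" for s k
    using \<alpha> by (simp add: one_sided_shift_def)
  have T: "strict_mono T"
    using L(2) by (simp add: strict_mono_Suc_iff T_def)
  obtain \<delta> where \<delta>: "\<delta> > 0"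
    "\<And>i j x y. i < N \<Longrightarrow> j < N \<Longrightarrow> i \<noteq> j \<Longrightarrow> x \<in> V i \<Longrightarrow> y \<in> V j \<Longrightarrow> \<delta> \<le> dist x y"
    using disjoint_compacts_separated[of N V] V by metis
  \<comment> \<open>Block \<open>j\<close> of every code starts with the first
    \<open>m j + 1\<close> symbols of \<beta>, whichever bit is read.\<close>
  have in_cylinder: "iter_from g 0 (T j) (x s) \<in> cylinder g W \<beta> (m j) (T j)" for j s
    unfolding cylinder_iff
  proof (intro allI impI)
    fix k assume k: "k \<le> m j"
    have "iter_from g (T j) k (iter_from g 0 (T j) (x s)) = iter_from g 0 (T j + k) (x s)"
      using iter_from_add[of g 0 "T j" k] by simp
    moreover have "\<alpha> s (T j + k) = \<beta> k"
      using \<alpha>w[of k j s] Q[of j] k by (simp add: Q_def)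
    ultimately show "iter_from g (T j) k (iter_from g 0 (T j) (x s)) \<in> W (\<beta> k) (T j + k)"
      using x[of "T j + k" s] by simp
  qed
  have "dist_chaotic_in_sequence g \<delta>"
  proof (rule dist_chaotic_if_synchronised[OF \<delta>(1) T])
    show "T j + r j < T (Suc j)" for j
      using L(1)[of j] by (simp add: T_def)
    show "infinite {l. odd l \<and> (h l \<in> s) \<noteq> (h l \<in> t)}" if "s \<noteq> t" for s t
      unfolding h_def using that by (rule infinite_odd_separating_levels)
    show "\<exists>K. \<forall>j\<ge>K. \<forall>s t. dist (iter_from g 0 (T j) (x s)) (iter_from g 0 (T j) (x t)) < \<epsilon>"
      if "\<epsilon> > 0" for \<epsilon>
    proof -
      \<comment> \<open>Shrinking holds along every increasing sequence of starting times, so it can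
        be applied to \<open>T\<close>, although \<open>T\<close> was built from
        \<open>m\<close>.\<close>
      have "strict_mono_on {1..} T"
        using T by (auto intro!: strict_mono_onI dest: strict_monoD)
      then have "(\<lambda>j. diameter (cylinder g W \<beta> (m j) (T j))) \<longlonglongrightarrow> 0"
        by (rule m)
      then have "\<forall>\<^sub>F j in sequentially. diameter (cylinder g W \<beta> (m j) (T j)) < \<epsilon>"
        using that by (rule order_tendstoD(2))
      then obtain K where K: "\<And>j. j \<ge> K \<Longrightarrow> diameter (cylinder g W \<beta> (m j) (T j)) < \<epsilon>"
        unfolding eventually_sequentially by blast
      \<comment> \<open>Boundedness is what makes \<open>diameter\<close> dominate distances: on
        unbounded sets it has the default value 0.\<close>
      have "bounded (cylinder g W \<beta> (m j) (T j))" for j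
        using compact_imp_bounded[OF X] bounded_subset by blast
      then have "dist (iter_from g 0 (T j) (x s)) (iter_from g 0 (T j) (x t)) \<le>
          diameter (cylinder g W \<beta> (m j) (T j))" for j s t
        using in_cylinder by (intro diameter_bounded_bound)
      with K show ?thesis
        by (meson le_less_trans)
    qed
    show "\<delta> \<le> dist (iter_from g 0 (T j + r j) (x s)) (iter_from g 0 (T j + r j) (x t))"
      if "(h (factorial_level j) \<in> s) \<noteq> (h (factorial_level j) \<in> t)" for j s t
    proof (rule \<delta>(2)[OF \<alpha>N \<alpha>N])
      \<comment> \<open>At the branching time the two codes carry the two different states of
        \<open>w j\<close>, so the orbits lie in different sets \<open>V\<close>.\<close>
      show "\<alpha> s (T j + r j) \<noteq> \<alpha> t (T j + r j)"
        using \<alpha>w[of "r j" j] L(1)[of j] Q[of j] that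
        by (cases "h (factorial_level j) \<in> s") (auto simp: Q_def)
    qed (use x W(2)[OF \<alpha>N] in blast)+
  qed
  then show ?thesis ..
qed

section \<open>Reductions to Condition (P)\<close>

text \<open>Each point of the last set is pulled back one step at a time through the covering
  relation. Prescribing the end point \<open>y\<close>, rather than asking only for nonemptiness, is
  what carries the induction.\<close>

lemma expanding_cylinder_onto:
  assumes W: "weakly_coupled_expanding g N A W" and \<alpha>: "\<alpha> \<in> one_sided_shift N A"
    and "y \<in> W (\<alpha> m) (n + m)"
  shows "\<exists>x \<in> cylinder g W \<alpha> m n. iter_from g n m x = y"
  using assms(3)
proof (induction m arbitrary: y)
  case 0
  then show ?case
    by (auto simp: cylinder_iff)
next
  case (Suc m)
  have "\<alpha> m < N" "\<alpha> (Suc m) \<in> {j. j < N \<and> A $$ (\<alpha> m, j) = 1}"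
    using \<alpha> by (simp_all add: one_sided_shift_def)
  then have "W (\<alpha> (Suc m)) (n + m + 1) \<subseteq> g (n + m) ` W (\<alpha> m) (n + m)"
    using W unfolding weakly_coupled_expanding_def by (meson UN_upper order_trans)
  then obtain z where z: "z \<in> W (\<alpha> m) (n + m)" "g (n + m) z = y"
    using Suc.prems by auto
  then obtain x where x: "x \<in> cylinder g W \<alpha> m n" "iter_from g n m x = z"
    using Suc.IH by blast
  have "iter_from g n (Suc m) x = y"
    using x(2) z(2) by simp
  moreover have "x \<in> cylinder g W \<alpha> (Suc m) n"
    using x(1) calculation Suc.prems by (simp add: cylinder_iff le_Suc_eq del: iter_from.simps)
  ultimately show ?case by blast
qed

lemma condition_Q_imp_P:
  assumes "condition_Q g"
  shows "condition_P g"
proof -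
  obtain N A V W where Q: "coding_setup g N A V W" "weakly_coupled_expanding g N A W"
      "shrinking_code g N A W"
    using assms unfolding condition_Q_def by blast
  have "cylinder g W \<alpha> m n \<noteq> {}" if \<alpha>: "\<alpha> \<in> one_sided_shift N A" for \<alpha> m n
  proof -
    have "\<alpha> m < N"
      using \<alpha> by (simp add: one_sided_shift_def)
    then have "W (\<alpha> m) (n + m) \<noteq> {}"
      using Q(1) unfolding coding_setup_def by blast
    then show ?thesis
      using expanding_cylinder_onto[OF Q(2) \<alpha>] by blast
  qed
  with Q show ?thesis
    unfolding condition_P_def by blast
qed

section \<open>Passing from an induced system to the original one\<close>

lemma continuous_on_induced_maps:
  assumes "\<And>n. continuous_on UNIV (f n)"
  shows "continuous_on UNIV (induced_maps f k n)"
  by (simp add: induced_maps_def continuous_on_iter_from[OF assms])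

text \<open>Each induced map starts at the time where the preceding one stops, so the composition
  telescopes. The case distinction replaces the meaningless value \<open>k 0\<close> by time
  0.\<close>

lemma iter_from_induced_maps:
  assumes k: "strict_mono_on {1..} k"
  shows "iter_from (induced_maps f k) 0 n = iter_from f 0 (if n = 0 then 0 else k n)"
proof (induction n)
  case (Suc n)
  show ?case
  proof (cases "n = 0")
    case True
    then show ?thesis
      by (simp add: induced_maps_def)
  next
    case False
    then have "k n < k (Suc n)"
      using strict_mono_onD[OF k, of n "Suc n"] by simp
    then show ?thesis
      using Suc False iter_from_add[of f 0 "k n" "k (Suc n) - k n"] by (simp add: induced_maps_def)
  qed
qed simp

text \<open>Observing the induced system at times \<open>p i\<close> is observing the original one
  at times \<open>K (p i)\<close>, with the same points and the same frequencies.\<close>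

lemma dist_chaotic_induced_imp:
  assumes k: "strict_mono_on {1..} k" "\<forall>n\<ge>1. k n > 0"
    and chaos: "dist_chaotic_in_sequence (induced_maps f k) \<delta>"
  shows "dist_chaotic_in_sequence f \<delta>"
proof -
  define K where "K n = (if n = 0 then 0 else k n)" for n
  have freq: "closeness_freq (induced_maps f k) p x y \<epsilon> n = closeness_freq f (\<lambda>i. K (p i)) x y \<epsilon> n"
    for p x y \<epsilon> n
    unfolding closeness_freq_def iter_from_induced_maps[OF k(1)] K_def ..
  obtain p D where \<delta>: "\<delta> > 0" and p: "strict_mono_on {1..} p" and D: "uncountable D"
    "\<forall>x\<in>D. \<forall>y\<in>D. x \<noteq> y \<longrightarrow> (\<forall>\<epsilon>>0.
       limsup (\<lambda>n. ereal (closeness_freq (induced_maps f k) p x y \<epsilon> n)) = 1 \<and>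
       liminf (\<lambda>n. ereal (closeness_freq (induced_maps f k) p x y \<delta> n)) = 0)"
    using chaos unfolding dist_chaotic_in_sequence_def by blast
  have "strict_mono_on {1..} (\<lambda>i. K (p i))"
  proof (rule strict_mono_onI)
    fix a b :: nat assume "a \<in> {1..}" "b \<in> {1..}" "a < b"
    then have "p a < p b"
      using p by (simp add: strict_mono_onD)
    \<comment> \<open>If \<open>p a = 0\<close>, this is positivity of \<open>k\<close>; otherwise
      it is monotonicity of \<open>k\<close>.\<close>
    then show "K (p a) < K (p b)"
      using k(2) strict_mono_onD[OF k(1), of "p a" "p b"] by (auto simp: K_def)
  qed
  with \<delta> D show ?thesis
    unfolding dist_chaotic_in_sequence_def freq by blast
qed

theorem theorem4p1:
  fixes f :: "nat \<Rightarrow> 'a::metric_space \<Rightarrow> 'a"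
  assumes compact_X: "compact (UNIV :: 'a set)"
    and continuous_f: "\<And>n. continuous_on UNIV (f n)"
    and conditions:
      "condition_P f \<or>
       condition_Q f \<or>
       (\<exists>k :: nat \<Rightarrow> nat. strict_mono_on {1..} k \<and> (\<forall>n\<ge>1. k n > 0) \<and>
          condition_P (induced_maps f k)) \<or>
       (\<exists>k :: nat \<Rightarrow> nat. strict_mono_on {1..} k \<and> (\<forall>n\<ge>1. k n > 0) \<and>
          condition_Q (induced_maps f k))"
  shows "\<exists>\<delta>>0. dist_chaotic_in_sequence f \<delta>"
proof -
  have P: "condition_P f \<or> (\<exists>k :: nat \<Rightarrow> nat. strict_mono_on {1..} k \<and> (\<forall>n\<ge>1. k n > 0) \<and>
      condition_P (induced_maps f k))"
    using conditions condition_Q_imp_P by blast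
  have "\<exists>\<delta>. dist_chaotic_in_sequence f \<delta>"
    using P
  proof (elim disjE exE conjE)
    assume "condition_P f"
    then show ?thesis
      by (rule condition_P_imp_dist_chaotic[OF compact_X continuous_f])
  next
    fix k :: "nat \<Rightarrow> nat"
    assume k: "strict_mono_on {1..} k" "\<forall>n\<ge>1. k n > 0" and P: "condition_P (induced_maps f k)"
    have "\<exists>\<delta>. dist_chaotic_in_sequence (induced_maps f k) \<delta>"
      using P by (rule condition_P_imp_dist_chaotic[OF compact_X
            continuous_on_induced_maps[OF continuous_f]])
    then show ?thesis
      using dist_chaotic_induced_imp[OF k] by blast
  qed
  then show ?thesis
    unfolding dist_chaotic_in_sequence_def by blast
qed

end
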